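(* For every $n\ge 1$ there exists a bijection $$\alpha:\mathfrak{S}_n(31245,32145,31254,32154)\to\mathfrak{S}_n(31425,32415,31524,32514)$$ such that for every $\pi$ in the domain, $$(\mathrm{Ides},\mathrm{Lrmax},\mathrm{Lrmin},\mathrm{Rlmax},\mathrm{Iar})(\pi)=(\mathrm{Ides},\mathrm{Lrmax},\mathrm{Lrmin},\mathrm{Rlmax},\mathrm{Iar})(\alpha(\pi)).$$
   Context: $\mathfrak{S}_n$ is the set of permutations of $[n]=\{1,\dots,n\}$, written as words $\pi=\pi_1\cdots\pi_n$. A permutation $\pi$ contains a pattern $P=p_1\cdots p_k$ (a permutation of $[k]$) if there are indices $i_1<\dots<i_k$ such that $\pi_{i_1}\cdots\pi_{i_k}$ is order-isomorphic to $P$; otherwise $\pi$ avoids $P$. $\mathfrak{S}_n(P_1,\dots,P_r)$ denotes the set of permutations in $\mathfrak{S}_n$ avoiding each of $P_1,\dots,P_r$. Statistics (set-valued): $\mathrm{Ides}(\pi)=\{i\in[n-1]:\pi^{-1}(i)>\pi^{-1}(i+1)\}$ (inverse descent set); $\mathrm{Lrmax}(\pi)$ = set of letters $\pi_i$ with $\pi_i>\pi_j$ for all $j<i$ (left-to-right maxima); $\mathrm{Lrmin}(\pi)$ = set of letters $\pi_i$ with $\pi_i<\pi_j$ for all $j<i$ (left-to-right minima); $\mathrm{Rlmax}(\pi)$ = set of letters $\pi_i$ with $\pi_i>\pi_j$ for all $j>i$ (right-to-left maxima); $\mathrm{Iar}(\pi)$ = set of letters in the initial ascending run of $\pi$, i.e.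 $\{\pi_1,\dots,\pi_m\}$ where $m$ is maximal with $\pi_1<\pi_2<\dots<\pi_m$. *)

theory Defs
  imports Main
begin

definition perms :: "nat \<Rightarrow> nat list set" where
  "perms n = {p. length p = n \<and> distinct p \<and> set p = {1..n}}"

definition contains :: "nat list \<Rightarrow> nat list \<Rightarrow> bool" where
  "contains p P \<longleftrightarrow> (\<exists>idx :: nat list. length idx = length P \<and> sorted_wrt (<) idx
      \<and> (\<forall>t\<in>set idx. t < length p)
      \<and> (\<forall>i<length P. \<forall>j<length P. (p ! (idx ! i) < p ! (idx ! j)) \<longleftrightarrow> (P ! i < P ! j)))"

definition avoiding :: "nat \<Rightarrow> nat list list \<Rightarrow> nat list set" where
  "avoiding n Ps = {p \<in> perms n. \<forall>P\<in>set Ps. \<not> contains p P}"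

definition Ides :: "nat list \<Rightarrow> nat set" where
  "Ides p = {i. 1 \<le> i \<and> i \<le> length p - 1 \<and>
      (\<exists>a b. a < b \<and> b < length p \<and> p ! a = i + 1 \<and> p ! b = i)}"

definition Lrmax :: "nat list \<Rightarrow> nat set" where
  "Lrmax p = {p ! i | i. i < length p \<and> (\<forall>j<i. p ! j < p ! i)}"

definition Lrmin :: "nat list \<Rightarrow> nat set" where
  "Lrmin p = {p ! i | i. i < length p \<and> (\<forall>j<i. p ! i < p ! j)}"

definition Rlmax :: "nat list \<Rightarrow> nat set" where
  "Rlmax p = {p ! i | i. i < length p \<and> (\<forall>j. i < j \<and> j < length p \<longrightarrow> p ! j < p ! i)}"

definition Iar :: "nat list \<Rightarrow> nat set" where
  "Iar p = {p ! i | i. i < length p \<and> (\<forall>j<i. p ! j < p ! Suc j)}"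

end

theory Submission
  imports Defs "HOL-Library.Sublist" "HOL-Library.Multiset"
begin

text \<open>
  Read the letters after a letter \<open>c\<close> as a word in S (smaller than \<open>c\<close>) and L (larger). The first
  class consists of the permutations in which no such word contains SSLL as a subsequence, the
  second of those in which none contains SLSL.

  Let \<open>c\<close> be the first letter, neither least nor greatest, and suppose that some L follows an S.
  Avoiding SSLL forces the word of \<open>c\<close> to be \<open>L\<^sup>i S L\<^sup>x S\<^sup>y L S\<^sup>k\<close>, avoiding SLSL forces
  \<open>L\<^sup>i S S\<^sup>y L\<^sup>x L S\<^sup>k\<close>. In both classes the conditions at the small letters only see the
  small subword together with one larger letter placed at the last L, and the conditions at the large
  letters only see the large subword together with one smaller letter placed at the first S. With
  \<open>c\<close> as that extra letter, a permutation in either class is thus encoded by two shorter permutations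
  of the same class, and the five statistics are determined by those of the two parts. Induction on
  the length gives the bijection.
\<close>

section \<open>Words relative to a letter\<close>

text \<open>The part of the pattern still unmatched after greedily embedding it into the word;
  \<open>True\<close> encodes S and \<open>False\<close> encodes L.\<close>

fun residual :: "bool list \<Rightarrow> bool list \<Rightarrow> bool list" where
  "residual [] w = []"
| "residual P [] = P"
| "residual (a # P) (x # w) = (if x = a then residual P w else residual (a # P) w)"

lemma residual_Nil2 [simp]: "residual P [] = P"
  by (cases P) auto

text \<open>Greedy matching is a left-to-right scan, so the part still unmatched after
  \<open>u\<close> is its entire state.\<close>

lemma residual_append [simp]: "residual P (u @ v) = residual (residual P u) v"
  by (induction P u rule: residual.induct) auto

text \<open>The scan only strips letters from the front, so its state ranges over the few suffixes
  of \<open>P\<close>; later proofs inspect these one by one.\<close>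

lemma suffix_residual: "suffix (residual P w) P"
  by (induction P w rule: residual.induct) (auto simp: suffix_Cons)

lemma residual_replicate_neq [simp]: "a \<noteq> b \<Longrightarrow> residual (a # P) (replicate n b) = a # P"
  by (induction n) auto

lemma residual_replicate_eq [simp]:
  "residual (a # P) (replicate n a) = (if n = 0 then a # P else residual P (replicate (n - 1) a))"
  by (cases n) auto

text \<open>A block of \<open>b\<close> cannot match the last letter of a nonempty \<open>P\<close>,
  hence cannot complete it.\<close>

lemma residual_replicate_last:
  assumes "P \<noteq> [] \<Longrightarrow> last P \<noteq> b"
  shows "residual P (replicate n b) = [] \<longleftrightarrow> P = []"
  using assms
proof (induction n arbitrary: P)
  case (Suc n)
  show ?case
  proof (cases P)
    case (Cons a Q)
    then show ?thesis using Suc.IH[of Q] Suc.IH[of P] Suc.prems by (auto split: if_splits)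
  qed simp
qed simp

text \<open>Greedy matching succeeds whenever any embedding exists.\<close>

lemma residual_eq_Nil_iff: "residual P w = [] \<longleftrightarrow> subseq P w"
  by (induction P w rule: residual.induct) (auto simp: subseq_Cons2_iff)

lemma subseq_Cons_iff_nth:
  "subseq (a # P) w \<longleftrightarrow> (\<exists>i<length w. w ! i = a \<and> subseq P (drop (Suc i) w))"
proof
  assume "subseq (a # P) w"
  then obtain u v where "w = u @ a # v" "subseq P v"
    by (auto dest: list_emb_ConsD)
  then show "\<exists>i<length w. w ! i = a \<and> subseq P (drop (Suc i) w)"
    by (intro exI[of _ "length u"]) auto
next
  assume "\<exists>i<length w. w ! i = a \<and> subseq P (drop (Suc i) w)"
  then obtain i where "i < length w" "w ! i = a" "subseq P (drop (Suc i) w)" by blast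
  then show "subseq (a # P) w"
    by (metis id_take_nth_drop list_emb_append2 subseq_Cons2)
qed

definition below :: "nat \<Rightarrow> nat list \<Rightarrow> bool list" where
  "below d = map (\<lambda>x. x < d)"

lemma below_simps [simp]:
  "below d [] = []" "below d (x # p) = (x < d) # below d p" "below d (p @ q) = below d p @ below d q"
  by (auto simp: below_def)

lemma below_smaller:
  "\<forall>x\<in>set p. x < c \<Longrightarrow> c \<le> d \<Longrightarrow> below d p = replicate (length p) True"
  by (induction p) auto

lemma below_larger:
  "\<forall>x\<in>set p. c < x \<Longrightarrow> d \<le> c \<Longrightarrow> below d p = replicate (length p) False"
  by (induction p) auto

text \<open>Only the letters of the first list are tested as possible first letters of an occurrence;
  the second list is the context that follows them.\<close>

fun free :: "bool list \<Rightarrow> nat list \<Rightarrow> nat list \<Rightarrow> bool" where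
  "free P [] R \<longleftrightarrow> True"
| "free P (d # L) R \<longleftrightarrow> residual P (below d (L @ R)) \<noteq> [] \<and> free P L R"

lemma free_append [simp]: "free P (L @ M) R \<longleftrightarrow> free P L (M @ R) \<and> free P M R"
  by (induction L) auto

text \<open>When the scan reaches the context, its state is some suffix of \<open>P\<close>.
  Contexts that complete the same suffixes, as seen from each letter of \<open>L\<close>, are
  therefore interchangeable.\<close>

lemma free_cong:
  assumes "\<And>d s. d \<in> set L \<Longrightarrow> suffix s P \<Longrightarrow>
    residual s (below d R) = [] \<longleftrightarrow> residual s (below d R') = []"
  shows "free P L R \<longleftrightarrow> free P L R'"
  using assms by (induction L) (auto simp: suffix_residual)

abbreviation SSLL :: "bool list" where "SSLL \<equiv> [True, True, False, False]"
abbreviation SLSL :: "bool list" where "SLSL \<equiv> [True, False, True, False]"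

text \<open>The letter set is arbitrary because the two parts of a word live on the intervals
  \<open>{a..<Suc c}\<close> and \<open>{c..<b}\<close>, which share \<open>c\<close>.\<close>

definition Av :: "bool list \<Rightarrow> nat set \<Rightarrow> nat list set" where
  "Av P S = {p. distinct p \<and> set p = S \<and> free P p []}"

section \<open>Statistics\<close>

text \<open>Without the range condition of \<open>Ides\<close> the set makes sense for words on any
  letters and can be computed letter by letter.\<close>

definition Ids :: "nat list \<Rightarrow> nat set" where
  "Ids p = {i. \<exists>a b. a < b \<and> b < length p \<and> p ! a = i + 1 \<and> p ! b = i}"

lemma Ids_Nil [simp]: "Ids [] = {}"
  by (auto simp: Ids_def)

lemma Ids_Cons [simp]: "Ids (x # p) = {i \<in> set p. i + 1 = x} \<union> Ids p"
proof -
  have "(\<exists>a b. a < b \<and> b < length (x # p) \<and> (x # p) ! a = i + 1 \<and> (x # p) ! b = i)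
    \<longleftrightarrow> (i \<in> set p \<and> i + 1 = x) \<or> (\<exists>a b. a < b \<and> b < length p \<and> p ! a = i + 1 \<and> p ! b = i)"
    (is "?l \<longleftrightarrow> ?r1 \<or> ?r2") for i
  proof
    assume ?l
    then obtain a b where ab: "a < b" "b < Suc (length p)" "(x # p) ! a = i + 1" "(x # p) ! b = i"
      by auto
    then obtain b' where b': "b = Suc b'" by (cases b) auto
    show "?r1 \<or> ?r2" using ab b' by (cases a) (auto simp: in_set_conv_nth)
  next
    assume "?r1 \<or> ?r2"
    then show ?l
    proof
      assume ?r1
      then obtain k where "k < length p" "p ! k = i" "x = i + 1" by (auto simp: in_set_conv_nth)
      then show ?l by (intro exI[of _ 0] exI[of _ "Suc k"]) auto
    next
      assume ?r2
      then obtain a b where "a < b" "b < length p" "p ! a = i + 1" "p ! b = i" by blast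
      then show ?l by (intro exI[of _ "Suc a"] exI[of _ "Suc b"]) auto
    qed
  qed
  then show ?thesis unfolding Ids_def by blast
qed

lemma Ids_subset: "Ids p \<subseteq> set p \<inter> {i. Suc i \<in> set p}"
  by (induction p) auto

lemma stat_Nil [simp]: "Lrmax [] = {}" "Lrmin [] = {}" "Rlmax [] = {}" "Iar [] = {}"
  by (auto simp: Lrmax_def Lrmin_def Rlmax_def Iar_def)

lemma ex_nat_Suc: "(\<exists>i. Q i) \<longleftrightarrow> Q 0 \<or> (\<exists>i. Q (Suc i))"
  by (metis not0_implies_Suc)

lemma all_nat_Suc: "(\<forall>i. Q i) \<longleftrightarrow> Q 0 \<and> (\<forall>i. Q (Suc i))"
  by (metis not0_implies_Suc)

lemma Lrmax_Cons [simp]: "Lrmax (x # p) = insert x {y \<in> Lrmax p. x < y}"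
  unfolding Lrmax_def by (subst ex_nat_Suc) (auto simp: All_less_Suc2)

lemma Lrmin_Cons [simp]: "Lrmin (x # p) = insert x {y \<in> Lrmin p. y < x}"
  unfolding Lrmin_def by (subst ex_nat_Suc) (auto simp: All_less_Suc2)

lemma Rlmax_Cons [simp]:
  "Rlmax (x # p) = (if \<forall>y\<in>set p. y < x then insert x (Rlmax p) else Rlmax p)"
proof -
  have "(\<forall>j. i < j \<and> j < length (x # p) \<longrightarrow> (x # p) ! j < v) \<longleftrightarrow>
      (case i of 0 \<Rightarrow> \<forall>y\<in>set p. y < v | Suc i \<Rightarrow> \<forall>j. i < j \<and> j < length p \<longrightarrow> p ! j < v)" for i v
    by (subst all_nat_Suc) (auto simp: all_set_conv_all_nth split: nat.split)
  then show ?thesis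
    unfolding Rlmax_def by (subst ex_nat_Suc) auto
qed

lemma Iar_Cons [simp]:
  "Iar (x # p) = insert x (if p \<noteq> [] \<and> x < hd p then Iar p else {})"
  by (cases p) (auto simp: Iar_def ex_nat_Suc[of "\<lambda>i. _ = (x # _) ! i \<and> _ i"] All_less_Suc2)

lemma Lrmax_subset: "Lrmax p \<subseteq> set p" by (induction p) auto
lemma Lrmin_subset: "Lrmin p \<subseteq> set p" by (induction p) auto
lemma Rlmax_subset: "Rlmax p \<subseteq> set p" by (induction p) auto
lemma Iar_subset: "Iar p \<subseteq> set p" by (induction p) auto

definition st :: "nat list \<Rightarrow> nat set \<times> nat set \<times> nat set \<times> nat set \<times> nat set" where
  "st p = (Ids p, Lrmax p, Lrmin p, Rlmax p, Iar p)"

section \<open>Splitting at the first letter\<close>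

text \<open>\<open>hi c p\<close> consists of the letters of \<open>p\<close> above \<open>c\<close>, with \<open>c\<close> at the place of the first smaller
  letter (at the end if there is none); \<open>lo c p\<close> consists of the letters below \<open>c\<close>, with \<open>c\<close> at the
  place of the last larger letter (at the front if there is none).\<close>

fun hi :: "nat \<Rightarrow> nat list \<Rightarrow> nat list" where
  "hi c [] = [c]"
| "hi c (x # p) = (if x < c then c # filter (\<lambda>y. c < y) p else x # hi c p)"

fun lo :: "nat \<Rightarrow> nat list \<Rightarrow> nat list" where
  "lo c [] = [c]"
| "lo c (x # p) = (if \<forall>y\<in>set (x # p). y < c then c # x # p
     else if x < c then x # lo c p else lo c p)"

lemma set_hi: "c \<notin> set p \<Longrightarrow> set (hi c p) = insert c {x \<in> set p. c < x}"
proof (induction p)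
  case (Cons x p)
  show ?case
  proof (cases "x < c")
    case False
    then show ?thesis using Cons by (simp add: neq_iff) blast
  qed auto
qed simp

declare lo.simps(2) [simp del]

text \<open>This rule and the next two replace the recursion equation of \<open>lo\<close>, whose
  first branch tests the whole remaining word.\<close>

lemma lo_smaller: "\<forall>y\<in>set p. y < c \<Longrightarrow> lo c p = c # p"
  by (cases p) (auto simp: lo.simps)

lemma lo_Cons_smaller: "x < c \<Longrightarrow> y \<in> set p \<Longrightarrow> c < y \<Longrightarrow> lo c (x # p) = x # lo c p"
  by (simp add: lo.simps) (meson not_less_iff_gr_or_eq)

lemma lo_Cons_larger [simp]: "c < x \<Longrightarrow> lo c (x # p) = lo c p"
  by (auto simp: lo.simps)

text \<open>Mirrors the evaluation of \<open>lo\<close>: it stops once no larger letter remains, and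
  until then keeps smaller letters and drops larger ones.\<close>

lemma lo_induct [consumes 1, case_names smaller Cons_smaller Cons_larger]:
  fixes c :: nat
  assumes "c \<notin> set p"
    and "\<And>p. \<forall>y\<in>set p. y < c \<Longrightarrow> Q p"
    and "\<And>x y p. x < c \<Longrightarrow> y \<in> set p \<Longrightarrow> c < y \<Longrightarrow> c \<notin> set p \<Longrightarrow> Q p \<Longrightarrow> Q (x # p)"
    and "\<And>x p. c < x \<Longrightarrow> c \<notin> set p \<Longrightarrow> Q p \<Longrightarrow> Q (x # p)"
  shows "Q p"
  using assms(1)
proof (induction p)
  case Nil
  then show ?case using assms(2) by simp
next
  case (Cons x p)
  then have Qp: "Q p" and c: "c \<notin> set p" "x \<noteq> c" by auto
  consider "c < x" | "x < c" "\<forall>y\<in>set p. y < c" | y where "x < c" "y \<in> set p" "c < y"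
    using c by (metis linorder_neqE_nat)
  then show ?case
  proof cases
    case 2
    then show ?thesis by (intro assms(2)) auto
  qed (use Qp c assms in blast)+
qed

lemma set_lo: "c \<notin> set p \<Longrightarrow> set (lo c p) = insert c {x \<in> set p. x < c}"
proof (induction p rule: lo_induct)
  case (smaller p)
  then have "{x \<in> set p. x < c} = set p" by blast
  then show ?case using smaller by (simp add: lo_smaller)
next
  case (Cons_smaller x y p)
  then have "{z \<in> set (x # p). z < c} = insert x {z \<in> set p. z < c}" by auto
  then show ?case using Cons_smaller by (simp add: lo_Cons_smaller insert_commute)
next
  case (Cons_larger x p)
  then have "{z \<in> set (x # p). z < c} = {z \<in> set p. z < c}" by auto
  then show ?case using Cons_larger by simp
qed

section \<open>Reading the statistics off the two parts\<close>

lemma Lrmax_filter: "c < y \<Longrightarrow> y \<in> Lrmax (filter (\<lambda>y. c < y) p) \<longleftrightarrow> y \<in> Lrmax p"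
  by (induction p) auto

text \<open>For \<open>y\<close> above \<open>c\<close>, every letter up to \<open>c\<close> passes
  the comparison with \<open>y\<close>, so deleting the smaller letters and inserting
  \<open>c\<close> anywhere changes nothing. \<open>Rlmax_hi\<close> has the same reason.\<close>

lemma Lrmax_hi: "c \<notin> set p \<Longrightarrow> c < y \<Longrightarrow> y \<in> Lrmax (hi c p) \<longleftrightarrow> y \<in> Lrmax p"
  by (induction p) (auto simp: Lrmax_filter set_hi)

lemma Rlmax_filter: "c < y \<Longrightarrow> y \<in> Rlmax (filter (\<lambda>y. c < y) p) \<longleftrightarrow> y \<in> Rlmax p"
proof (induction p)
  case (Cons x p)
  show ?case
  proof (cases "c < x")
    case True
    then have "(\<forall>z\<in>set (filter (\<lambda>y. c < y) p). z < x) \<longleftrightarrow> (\<forall>z\<in>set p. z < x)"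
      unfolding set_filter mem_Collect_eq Ball_def by (meson le_less_trans not_le)
    then show ?thesis using Cons True by (simp del: set_filter)
  qed (use Cons in simp)
qed simp

lemma Rlmax_hi: "c \<notin> set p \<Longrightarrow> c < y \<Longrightarrow> y \<in> Rlmax (hi c p) \<longleftrightarrow> y \<in> Rlmax p"
proof (induction p)
  case (Cons x p)
  show ?case
  proof (cases "x < c")
    case True
    then have "y \<in> Rlmax (hi c (x # p)) \<longleftrightarrow> y \<in> Rlmax (filter (\<lambda>y. c < y) p)"
      using Cons.prems by simp
    then show ?thesis using True Cons.prems by (simp add: Rlmax_filter)
  next
    case False
    then have "c < x" using Cons.prems by auto
    then have "(\<forall>z\<in>set (hi c p). z < x) \<longleftrightarrow> (\<forall>z\<in>set p. z < x)"
      using Cons.prems unfolding set_hi[OF Cons.prems(1)[simplified, THEN conjunct2]] Ball_def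
      by (metis (no_types, lifting) insert_iff linorder_neqE_nat mem_Collect_eq order.strict_trans)
    then show ?thesis using Cons False by simp
  qed
qed simp

lemma Ids_filter: "c < y \<Longrightarrow> y \<in> Ids (filter (\<lambda>y. c < y) p) \<longleftrightarrow> y \<in> Ids p"
  by (induction p) auto

lemma Ids_hi: "c \<notin> set p \<Longrightarrow> c < y \<Longrightarrow> y \<in> Ids (hi c p) \<longleftrightarrow> y \<in> Ids p"
  by (induction p) (auto simp: Ids_filter set_hi)

lemma Lrmin_lo: "c \<notin> set p \<Longrightarrow> y < c \<Longrightarrow> y \<in> Lrmin (lo c p) \<longleftrightarrow> y \<in> Lrmin p"
  by (induction p rule: lo_induct) (auto simp: lo_smaller lo_Cons_smaller set_lo)

text \<open>Here the place of \<open>c\<close> matters: \<open>c\<close> stands where the last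
  larger letter stood, so \<open>c\<close> follows \<open>y\<close> in \<open>lo c p\<close> exactly
  when some larger letter follows \<open>y\<close> in \<open>p\<close>.\<close>

lemma Rlmax_lo: "c \<notin> set p \<Longrightarrow> y < c \<Longrightarrow> y \<in> Rlmax (lo c p) \<longleftrightarrow> y \<in> Rlmax p"
  by (induction p rule: lo_induct) (auto simp: lo_smaller lo_Cons_smaller set_lo)

text \<open>The bound keeps both \<open>y\<close> and \<open>Suc y\<close> below \<open>c\<close>;
  an inverse descent at \<open>c - 1\<close> would involve the artificial position of
  \<open>c\<close>.\<close>

lemma Ids_lo: "c \<notin> set p \<Longrightarrow> Suc y < c \<Longrightarrow> y \<in> Ids (lo c p) \<longleftrightarrow> y \<in> Ids p"
  by (induction p rule: lo_induct) (auto simp: lo_smaller lo_Cons_smaller set_lo)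

text \<open>The ascending run ends at the latest before the first smaller letter, and in
  \<open>hi c p\<close> the letter \<open>c\<close> causes the descent there.\<close>

lemma Iar_hi: "c \<notin> set p \<Longrightarrow> p \<noteq> [] \<Longrightarrow> c < hd p \<Longrightarrow> Iar (hi c p) = Iar p"
proof (induction p)
  case (Cons x p)
  then show ?case by (cases p) auto
qed simp

text \<open>As \<open>c\<close> is the least letter of \<open>hi c p\<close>, it lies in the initial
  run only if it comes first, that is, if \<open>p\<close> is empty or starts below
  \<open>c\<close>; in both cases the run of \<open>c # p\<close> is just \<open>c\<close>.\<close>

lemma Iar_Cons_hi:
  assumes "c \<notin> set p"
  shows "Iar (c # p) = insert c (if c \<in> Iar (hi c p) then {} else Iar (hi c p))"
proof (cases p)
  case (Cons x q)
  show ?thesis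
  proof (cases "x < c")
    case False
    then have "Iar (hi c p) = Iar p" using assms Cons by (intro Iar_hi) auto
    then show ?thesis using Iar_subset[of p] assms Cons False by auto
  qed (use Cons in auto)
qed simp

text \<open>Both sides say that no larger letter follows a smaller one in \<open>p\<close>: then
  \<open>c\<close> is first in \<open>lo c p\<close>, where it is the greatest letter, and last in
  \<open>hi c p\<close>, where it is the least.\<close>

lemma split_compatible: "c \<notin> set p \<Longrightarrow> c \<in> Lrmin (lo c p) \<longleftrightarrow> c \<in> Rlmax (hi c p)"
proof (induction p rule: lo_induct)
  case (smaller p)
  then show ?case by (cases p) (auto simp: lo_smaller)
next
  case (Cons_smaller x y p)
  have "c \<notin> Rlmax (filter (\<lambda>y. c < y) p)" using Rlmax_subset by fastforce
  then show ?case using Cons_smaller by (auto simp: lo_Cons_smaller)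
next
  case (Cons_larger x p)
  then show ?case by auto
qed

text \<open>The letters \<open>c - 1\<close> and \<open>c\<close> are treated separately in the first component because the
  position of \<open>c\<close> in the two parts is artificial.\<close>

definition st_join ::
  "nat \<Rightarrow> nat set \<times> nat set \<times> nat set \<times> nat set \<times> nat set \<Rightarrow>
     nat set \<times> nat set \<times> nat set \<times> nat set \<times> nat set \<Rightarrow>
     nat set \<times> nat set \<times> nat set \<times> nat set \<times> nat set" where
  "st_join c = (\<lambda>(d, m, k, r, i) (d', m', k', r', i').
     (insert (c - 1) ({i \<in> d. Suc i < c} \<union> {i \<in> d'. c < i}),
      insert c {y \<in> m'. c < y}, insert c {y \<in> k. y < c},
      {y \<in> r. y < c} \<union> {y \<in> r'. c < y}, insert c (if c \<in> i' then {} else i')))"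

text \<open>Phrased through statistics, so that maps preserving \<open>st\<close> on each part carry
  compatible pairs to compatible pairs.\<close>

definition st_compatible ::
  "nat \<Rightarrow> nat set \<times> nat set \<times> nat set \<times> nat set \<times> nat set \<Rightarrow>
     nat set \<times> nat set \<times> nat set \<times> nat set \<times> nat set \<Rightarrow> bool" where
  "st_compatible c = (\<lambda>(d, m, k, r, i) (d', m', k', r', i'). c \<in> k \<longleftrightarrow> c \<in> r')"

text \<open>The first letter \<open>c\<close> makes \<open>c - 1\<close> an inverse descent and
  prevents \<open>c\<close> from being one. Every other question about the statistics is settled
  inside one of the two parts.\<close>

lemma st_Cons_split:
  assumes c: "c \<notin> set p" and "0 < c" "c - 1 \<in> set p" and "\<exists>y\<in>set p. c < y"
  shows "st (c # p) = st_join c (st (lo c p)) (st (hi c p))"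
proof -
  have "{i \<in> set p. i + 1 = c} = {c - 1}" using assms by auto
  moreover have "Ids p = {i \<in> Ids p. Suc i < c} \<union> {i \<in> Ids p. c < i}"
  proof -
    have "Suc i < c \<or> c < i" if "i \<in> Ids p" for i
    proof -
      have "i \<noteq> c" "Suc i \<noteq> c" using Ids_subset[of p] c that by auto
      then show ?thesis by linarith
    qed
    then show ?thesis by blast
  qed
  ultimately have "Ids (c # p) = insert (c - 1) ({i \<in> Ids (lo c p). Suc i < c} \<union> {i \<in> Ids (hi c p). c < i})"
    using Ids_lo[OF c] Ids_hi[OF c] by auto
  moreover have "Rlmax (c # p) = {y \<in> Rlmax p. y < c} \<union> {y \<in> Rlmax p. c < y}"
  proof -
    have "x < c \<or> c < x" if "x \<in> Rlmax p" for x
      using that c Rlmax_subset[of p] by (metis linorder_neqE_nat subsetD)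
    moreover have "\<not> (\<forall>y\<in>set p. y < c)" using assms(4) by (meson order.asym)
    then have "Rlmax (c # p) = Rlmax p" by (simp only: Rlmax_Cons if_False)
    ultimately show ?thesis by blast
  qed
  moreover have "{y \<in> Rlmax p. y < c} = {y \<in> Rlmax (lo c p). y < c}"
      "{y \<in> Rlmax p. c < y} = {y \<in> Rlmax (hi c p). c < y}"
      "{y \<in> Lrmin p. y < c} = {y \<in> Lrmin (lo c p). y < c}"
      "{y \<in> Lrmax p. c < y} = {y \<in> Lrmax (hi c p). c < y}"
    using Lrmax_hi[OF c] Lrmin_lo[OF c] Rlmax_lo[OF c] Rlmax_hi[OF c] by blast+
  moreover note Iar_Cons_hi[OF c]
  ultimately show ?thesis
    unfolding st_def st_join_def by (simp only: prod.case Lrmax_Cons Lrmin_Cons)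
qed

section \<open>Reassembling a permutation\<close>

lemma hi_append [simp]: "\<forall>x\<in>set L. c < x \<Longrightarrow> hi c (L @ q) = L @ hi c q"
  by (induction L) auto

lemma lo_append_larger:
  "\<forall>x\<in>set L. c < x \<Longrightarrow> lo c (L @ q) = lo c q"
  by (induction L) auto

lemma lo_append_smaller:
  "\<forall>x\<in>set X. x < c \<Longrightarrow> y \<in> set q \<Longrightarrow> c < y \<Longrightarrow> lo c (X @ q) = X @ lo c q"
  by (induction X) (auto simp: lo_Cons_smaller[where y = y])

lemma Rlmax_append_notin: "c \<notin> set L \<Longrightarrow> c \<in> Rlmax (L @ q) \<longleftrightarrow> c \<in> Rlmax q"
  by (induction L) auto

lemma Lrmin_greatest_iff: "\<forall>x\<in>set X. x < c \<Longrightarrow> c \<in> Lrmin (X @ c # S) \<longleftrightarrow> X = []"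
  by (cases X) auto

lemma Rlmax_least_iff:
  assumes "\<forall>y\<in>set L. c < y" "\<forall>y\<in>set Y. c < y"
  shows "c \<in> Rlmax (L @ c # Y) \<longleftrightarrow> Y = []"
proof -
  have "c \<notin> set L" "c \<notin> set Y" using assms by auto
  then show ?thesis
    using assms Rlmax_subset[of Y] by (cases Y) (auto simp: Rlmax_append_notin simp del: Rlmax_Cons, auto)
qed

text \<open>\<open>glue L X Y S\<close> is the unique list with word allowed by \<open>P\<close> and parts
  \<open>lo = X @ c # S\<close> and \<open>hi = L @ c # Y\<close>.\<close>

locale gluing =
  fixes P :: "bool list" and glue :: "nat list \<Rightarrow> nat list \<Rightarrow> nat list \<Rightarrow> nat list \<Rightarrow> nat list"
  assumes mset_glue: "X = [] \<longleftrightarrow> Y = [] \<Longrightarrow> mset (glue L X Y S) = mset L + mset X + mset Y + mset S"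
    and glue_parts:
      "\<lbrakk>X = [] \<longleftrightarrow> Y = []; \<forall>x\<in>set X \<union> set S. x < c; \<forall>x\<in>set L \<union> set Y. c < x\<rbrakk> \<Longrightarrow>
        lo c (glue L X Y S) = X @ c # S \<and> hi c (glue L X Y S) = L @ c # Y"
    and free_glue:
      "\<lbrakk>X = [] \<longleftrightarrow> Y = []; \<forall>x\<in>set X \<union> set S. x < c; \<forall>x\<in>set L \<union> set Y. c < x\<rbrakk> \<Longrightarrow>
        free P (c # glue L X Y S) [] \<longleftrightarrow> free P (X @ c # S) [] \<and> free P (L @ c # Y) []"
    and glue_exists:
      "\<lbrakk>c \<notin> set p; residual P (below c p) \<noteq> []\<rbrakk> \<Longrightarrow>
        \<exists>L X Y S. (X = [] \<longleftrightarrow> Y = []) \<and> (\<forall>x\<in>set X \<union> set S. x < c) \<and> (\<forall>x\<in>set L \<union> set Y. c < x) \<and>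
          p = glue L X Y S"
    and not_constant: "residual P (replicate n b) \<noteq> []"
begin

text \<open>Cutting the two parts at \<open>c\<close> recovers the arguments of \<open>glue\<close>,
  and compatibility is exactly the condition on \<open>X\<close> and \<open>Y\<close> under which
  \<open>glue\<close> inverts the decomposition.\<close>

lemma bij_betw_parts:
  assumes "a < c" "Suc c < b"
  shows "bij_betw (\<lambda>p. (lo c (tl p), hi c (tl p)))
    {p \<in> Av P {a..<b}. hd p = c}
    {(u, v) \<in> Av P {a..<Suc c} \<times> Av P {c..<b}. st_compatible c (st u) (st v)}"
    (is "bij_betw ?D ?X ?T")
proof -
  have X: "\<exists>L X Y S. (X = [] \<longleftrightarrow> Y = []) \<and> (\<forall>x\<in>set X \<union> set S. x < c) \<and> (\<forall>x\<in>set L \<union> set Y. c < x) \<and>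
      p = c # glue L X Y S" if "p \<in> ?X" for p
  proof -
    have p: "distinct p" "set p = {a..<b}" "free P p []" "hd p = c" using that by (auto simp: Av_def)
    then obtain q where q: "p = c # q" using assms by (cases p) auto
    then show ?thesis using p glue_exists[of c q] by auto
  qed
  have parts: "lo c (tl (c # glue L X Y S)) = X @ c # S" "hi c (tl (c # glue L X Y S)) = L @ c # Y"
    if "X = [] \<longleftrightarrow> Y = []" "\<forall>x\<in>set X \<union> set S. x < c" "\<forall>x\<in>set L \<union> set Y. c < x" for L X Y S
    using glue_parts[OF that] by auto
  have "inj_on ?D ?X"
  proof (rule inj_onI)
    fix p q assume "p \<in> ?X" "q \<in> ?X" and D: "?D p = ?D q"
    from X[OF \<open>p \<in> ?X\<close>] obtain L X Y S where 1: "X = [] \<longleftrightarrow> Y = []"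
      "\<forall>x\<in>set X \<union> set S. x < c" "\<forall>x\<in>set L \<union> set Y. c < x" "p = c # glue L X Y S" by blast
    from X[OF \<open>q \<in> ?X\<close>] obtain L' X' Y' S' where 2: "X' = [] \<longleftrightarrow> Y' = []"
      "\<forall>x\<in>set X' \<union> set S'. x < c" "\<forall>x\<in>set L' \<union> set Y'. c < x" "q = c # glue L' X' Y' S'" by blast
    have "X @ c # S = X' @ c # S'" "L @ c # Y = L' @ c # Y'"
      using D parts[OF 1(1-3)] parts[OF 2(1-3)] 1(4) 2(4) by auto
    \<comment> \<open>\<open>c\<close> does not recur on either side of the cut, so both cuts are
      unique and all four arguments of \<open>glue\<close> agree.\<close>
    moreover have "c \<notin> set X" "c \<notin> set S" "c \<notin> set L" "c \<notin> set Y" using 1 by auto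
    ultimately show "p = q" using 1(4) 2(4) by (simp add: append_Cons_eq_iff)
  qed
  moreover have "?D p \<in> ?T" if "p \<in> ?X" for p
  proof -
    have p: "distinct p" "set p = {a..<b}" "free P p []" using that by (auto simp: Av_def)
    from X[OF that] obtain L X Y S where 1: "X = [] \<longleftrightarrow> Y = []"
      "\<forall>x\<in>set X \<union> set S. x < c" "\<forall>x\<in>set L \<union> set Y. c < x" "p = c # glue L X Y S" by blast
    let ?g = "glue L X Y S"
    have g: "mset ?g = mset (L @ X @ Y @ S)" using mset_glue[OF 1(1)] by simp
    have "distinct ?g" "c \<notin> set ?g" using p 1(4) by auto
    moreover have "distinct ?g \<longleftrightarrow> distinct (L @ X @ Y @ S)" "set ?g = set (L @ X @ Y @ S)"
      using g by (fact mset_eq_imp_distinct_iff, fact mset_eq_setD)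
    ultimately have dist: "distinct (X @ c # S)" "distinct (L @ c # Y)" using 1 by auto
    have "set ?g = {a..<b} - {c}" using p 1(4) \<open>c \<notin> set ?g\<close> by auto
    moreover have "insert c {x \<in> {a..<b} - {c}. x < c} = {a..<Suc c}"
        "insert c {x \<in> {a..<b} - {c}. c < x} = {c..<b}"
      using assms by auto
    ultimately have "set (lo c ?g) = {a..<Suc c}" "set (hi c ?g) = {c..<b}"
      unfolding set_lo[OF \<open>c \<notin> set ?g\<close>] set_hi[OF \<open>c \<notin> set ?g\<close>] by simp_all
    then have "set (X @ c # S) = {a..<Suc c}" "set (L @ c # Y) = {c..<b}"
      using parts[OF 1(1-3)] by simp_all
    moreover have "free P (X @ c # S) []" "free P (L @ c # Y) []"
      using p 1(4) free_glue[OF 1(1-3)] by auto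
    moreover have "st_compatible c (st (lo c ?g)) (st (hi c ?g))"
      using split_compatible[OF \<open>c \<notin> set ?g\<close>] by (simp add: st_compatible_def st_def)
    ultimately show ?thesis using dist parts[OF 1(1-3)] 1(4) by (simp add: Av_def)
  qed
  moreover have "t \<in> ?D ` ?X" if t: "t \<in> ?T" for t
  proof -
    obtain u v where uv: "t = (u, v)" "distinct u" "set u = {a..<Suc c}" "free P u []"
      "distinct v" "set v = {c..<b}" "free P v []" "st_compatible c (st u) (st v)"
      using t by (auto simp: Av_def)
    have "c \<in> set u" "c \<in> set v" using uv assms by auto
    then obtain X S L Y where u: "u = X @ c # S" and v: "v = L @ c # Y" by (meson split_list)
    have 2: "\<forall>x\<in>set X \<union> set S. x < c"
    proof
      fix x assume "x \<in> set X \<union> set S"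
      then have "x \<in> set u" "x \<noteq> c" using u uv(2) by auto
      then show "x < c" using uv(3) by auto
    qed
    have 3: "\<forall>x\<in>set L \<union> set Y. c < x"
    proof
      fix x assume "x \<in> set L \<union> set Y"
      then have "x \<in> set v" "x \<noteq> c" using v uv(5) by auto
      then show "c < x" using uv(6) by auto
    qed
    \<comment> \<open>The greatest letter \<open>c\<close> of \<open>u\<close> is a left-to-right
      minimum only in first place, and the least letter \<open>c\<close> of \<open>v\<close> is a
      right-to-left maximum only in last place.\<close>
    have 1: "X = [] \<longleftrightarrow> Y = []"
      using uv(8) Lrmin_greatest_iff[of X c S] Rlmax_least_iff[of L c Y] 2 3 u v
      by (simp add: st_compatible_def st_def)
    let ?g = "glue L X Y S"
    have g: "mset ?g = mset (L @ X @ Y @ S)" using mset_glue[OF 1] by simp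
    then have g': "distinct ?g \<longleftrightarrow> distinct (L @ X @ Y @ S)" "set ?g = set (L @ X @ Y @ S)"
      by (fact mset_eq_imp_distinct_iff, fact mset_eq_setD)
    have "(set L \<union> set Y) \<inter> (set X \<union> set S) = {}"
      using 2 3 by (metis disjoint_iff order.asym)
    then have "distinct (c # ?g)" using g' uv u v 2 3 by auto
    moreover have "set (c # ?g) = set u \<union> set v" using g' u v by auto
    then have "set (c # ?g) = {a..<b}" using uv assms by auto
    moreover have "free P (c # ?g) []" using free_glue[OF 1 2 3] uv u v by simp
    ultimately have "c # ?g \<in> ?X" by (simp add: Av_def)
    moreover have "?D (c # ?g) = t" using parts[OF 1 2 3] uv u v by simp
    ultimately show ?thesis by (metis (no_types, lifting) image_eqI)
  qed
  ultimately show ?thesis unfolding bij_betw_def by blast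
qed

text \<open>Seen from the least letter all others are L. By \<open>not_constant\<close> such a word
  never completes \<open>P\<close>, so this first letter imposes no condition; a greatest first
  letter behaves likewise.\<close>

lemma Av_hd_least:
  assumes "a < b"
  shows "{p \<in> Av P {a..<b}. hd p = a} = Cons a ` Av P {Suc a..<b}"
proof -
  have ins: "{a..<b} = insert a {Suc a..<b}" using assms by auto
  have "a # p \<in> Av P {a..<b} \<longleftrightarrow> p \<in> Av P {Suc a..<b}" for p
  proof -
    have "a \<notin> set p \<and> insert a (set p) = {a..<b} \<longleftrightarrow> set p = {Suc a..<b}"
      unfolding ins using insert_ident[of a "set p" "{Suc a..<b}"] by auto
    moreover have "residual P (below a p) \<noteq> []" if "set p = {Suc a..<b}"
    proof -
      have "\<forall>x\<in>set p. a < x" using that by simp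
      then show ?thesis using below_larger[of p a a] not_constant by simp
    qed
    ultimately show ?thesis unfolding Av_def by simp blast
  qed
  moreover have "[] \<notin> Av P {a..<b}" unfolding Av_def ins by simp
  ultimately show ?thesis
    by (intro set_eqI, rename_tac p, case_tac p) auto
qed

lemma Av_hd_greatest:
  assumes "a \<le> c"
  shows "{p \<in> Av P {a..<Suc c}. hd p = c} = Cons c ` Av P {a..<c}"
proof -
  have ins: "{a..<Suc c} = insert c {a..<c}" using assms by auto
  have "c # p \<in> Av P {a..<Suc c} \<longleftrightarrow> p \<in> Av P {a..<c}" for p
  proof -
    have "c \<notin> set p \<and> insert c (set p) = {a..<Suc c} \<longleftrightarrow> set p = {a..<c}"
      unfolding ins using insert_ident[of c "set p" "{a..<c}"] by auto
    moreover have "residual P (below c p) \<noteq> []" if "set p = {a..<c}"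
    proof -
      have "\<forall>x\<in>set p. x < c" using that by simp
      then show ?thesis using below_smaller[of p c c] not_constant by simp
    qed
    ultimately show ?thesis unfolding Av_def by simp blast
  qed
  moreover have "[] \<notin> Av P {a..<Suc c}" unfolding Av_def ins by simp
  ultimately show ?thesis
    by (intro set_eqI, rename_tac p, case_tac p) auto
qed

end

section \<open>Partial matches along constant blocks\<close>

text \<open>The block contains at most one L, so it completes only the suffixes \<open>[]\<close>
  and \<open>[False]\<close>, for which the S letters around \<open>q\<close> are
  irrelevant.\<close>

lemma residual_block_cong:
  assumes "suffix s SSLL"
  shows "residual s (replicate k True @ [q] @ replicate m True) = [] \<longleftrightarrow> residual s [q] = []"
proof -
  let ?t = "residual s (replicate k True @ [q])"
  have "suffix ?t SSLL" using assms suffix_residual suffix_order.trans by blast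
  then have "?t \<noteq> [] \<Longrightarrow> last ?t \<noteq> True" by (auto simp: suffix_Cons)
  then have "residual ?t (replicate m True) = [] \<longleftrightarrow> ?t = []" by (rule residual_replicate_last)
  moreover have "?t = [] \<longleftrightarrow> residual s [q] = []"
    using assms by (auto simp: suffix_Cons split: if_splits)
  ultimately show ?thesis by (simp only: residual_append)
qed

text \<open>Both patterns end in L, so trailing S letters complete nothing.\<close>

lemma residual_trailing:
  assumes "suffix s SSLL \<or> suffix s SLSL"
  shows "residual s (w @ replicate m True) = [] \<longleftrightarrow> residual s w = []"
proof -
  have "suffix (residual s w) SSLL \<or> suffix (residual s w) SLSL"
    using assms suffix_residual suffix_order.trans by blast
  then have "residual s w \<noteq> [] \<Longrightarrow> last (residual s w) \<noteq> True" by (auto simp: suffix_Cons)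
  then show ?thesis by (simp add: residual_replicate_last)
qed

section \<open>The shape of a word forced by avoidance\<close>

lemma residual_singleton: "residual [e] w \<noteq> [] \<longleftrightarrow> e \<notin> set w"
  by (induction w) auto

text \<open>Used for the middle of a word, with \<open>e = True\<close> for SSLL and
  \<open>e = False\<close> for SLSL: forbidding one order of the two kinds puts all letters of one
  kind in front.\<close>

lemma two_blocks:
  assumes "\<not> subseq [e, \<not> e] (below c M)"
  shows "\<exists>U V. M = U @ V \<and> (\<forall>x\<in>set U. (x < c) = (\<not> e)) \<and> (\<forall>x\<in>set V. (x < c) = e)"
  using assms unfolding residual_eq_Nil_iff[symmetric]
proof (induction M)
  case (Cons x M)
  show ?case
  proof (cases "(x < c) = e")
    case True
    then have "(\<not> e) \<notin> set (below c M)"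
      using Cons.prems by (simp add: residual_singleton)
    then have "\<forall>y\<in>set M. (y < c) = e" by (auto simp: below_def)
    then show ?thesis using True by (intro exI[of _ "[]"] exI[of _ "x # M"]) auto
  next
    case False
    then obtain U V where "M = U @ V" "\<forall>x\<in>set U. (x < c) = (\<not> e)" "\<forall>x\<in>set V. (x < c) = e"
      using Cons by auto
    then show ?thesis using False by (intro exI[of _ "x # U"] exI[of _ V]) auto
  qed
qed simp

text \<open>In the second case \<open>x\<close> and \<open>l\<close> are the best places for the
  first S and the last L of either pattern, so avoidance becomes a condition on
  \<open>M\<close>.\<close>

lemma first_smaller_last_larger:
  fixes c :: nat
  assumes "c \<notin> set p"
  obtains L S where "p = L @ S" "\<forall>x\<in>set L. c < x" "\<forall>x\<in>set S. x < c"
  | L x M l S where "p = L @ x # M @ l # S" "\<forall>x\<in>set L. c < x" "x < c" "c < l" "\<forall>x\<in>set S. x < c"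
proof (cases "\<exists>x\<in>set p. x < c")
  case False
  then have "\<forall>x\<in>set p. c < x" using assms by (metis linorder_neqE_nat)
  then show ?thesis using that(1)[of p "[]"] by simp
next
  case True
  then obtain L x R where p: "p = L @ x # R" "x < c" "\<forall>y\<in>set L. \<not> y < c"
    using split_list_first_prop[of p "\<lambda>x. x < c"] by blast
  have neq: "c \<notin> set L" "c \<notin> set R" using assms p by auto
  have L: "\<forall>y\<in>set L. c < y" using p(3) neq by (metis linorder_neqE_nat)
  show ?thesis
  proof (cases "\<exists>l\<in>set R. c < l")
    case False
    then have "\<forall>y\<in>set (x # R). y < c" using p(2) neq by (metis linorder_neqE_nat set_ConsD)
    then show ?thesis using that(1)[OF p(1) L] by blast
  next
    case True
    then obtain M l S where R: "R = M @ l # S" "c < l" "\<forall>y\<in>set S. \<not> c < y"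
      using split_list_last_prop[of R "\<lambda>x. c < x"] by blast
    have "c \<notin> set S" using neq R by auto
    then have "\<forall>y\<in>set S. y < c" using R(3) by (metis linorder_neqE_nat)
    then show ?thesis using that(2)[of L x M l S] p R L by simp
  qed
qed

text \<open>Both patterns have the form S \<open>N\<close> L, with \<open>N\<close> equal to SL for
  SSLL and to LS for SLSL.\<close>

lemma subseq_middle:
  assumes "subseq N (below c M)" "x < c" "c < l"
  shows "subseq (True # N @ [False]) (below c (L @ x # M @ l # S))"
proof -
  have "subseq (N @ [False]) (below c M @ [False])"
    using assms(1) by (intro list_emb_append_mono) auto
  then have "subseq (True # N @ [False]) (True # below c M @ [False])" by simp
  then have "subseq (True # N @ [False]) ((True # below c M @ [False]) @ below c S)"
    using list_emb_append_mono[OF _ list_emb_Nil] by fastforce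
  then have "subseq (True # N @ [False]) (below c L @ (True # below c M @ [False]) @ below c S)"
    by (rule list_emb_append2)
  then show ?thesis using assms by simp
qed

section \<open>The two gluings\<close>

lemma filter_larger: "\<forall>x\<in>set p. x < c \<Longrightarrow> filter ((<) (c :: nat)) p = []"
  by (induction p) auto

lemma larger_then_smaller_parts:
  assumes "\<forall>x\<in>set S. x < c" "\<forall>x\<in>set L. c < x"
  shows "lo c (L @ S) = c # S \<and> hi c (L @ S) = L @ [c]"
proof -
  have "hi c S = [c]" using assms(1) by (cases S) (auto simp: filter_larger)
  then show ?thesis using assms by (simp add: lo_append_larger lo_smaller)
qed

text \<open>Between the first letter of \<open>X\<close> and the last of \<open>Y\<close>, the rest
  of \<open>Y\<close> precedes the rest of \<open>X\<close>. The forms with \<open>take\<close> and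
  \<open>drop\<close> also cover empty \<open>X\<close> and \<open>Y\<close>, where the result is
  \<open>L @ S\<close>.\<close>

definition glue_SSLL :: "nat list \<Rightarrow> nat list \<Rightarrow> nat list \<Rightarrow> nat list \<Rightarrow> nat list" where
  "glue_SSLL L X Y S = L @ take 1 X @ butlast Y @ tl X @ drop (length Y - 1) Y @ S"

text \<open>The same outer letters, with the two rests in the opposite order; this collapses to
  \<open>X @ Y\<close>.\<close>

definition glue_SLSL :: "nat list \<Rightarrow> nat list \<Rightarrow> nat list \<Rightarrow> nat list \<Rightarrow> nat list" where
  "glue_SLSL L X Y S = L @ X @ Y @ S"

lemma glue_SSLL_simps [simp]:
  "glue_SSLL L [] [] S = L @ S"
  "glue_SSLL L (x # X) (Y @ [l]) S = L @ x # Y @ X @ l # S"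
  by (auto simp: glue_SSLL_def)

lemma parts_cases:
  assumes "X = [] \<longleftrightarrow> Y = []"
  obtains "X = []" "Y = []" | x X' Y' l where "X = x # X'" "Y = Y' @ [l]"
  using assms by (cases X; cases Y rule: rev_cases) auto

text \<open>The degenerate case of both gluings. From a letter of \<open>L\<close>, the block
  \<open>S\<close> and the single \<open>c\<close> are both final S blocks, which cannot complete a
  pattern ending in L.\<close>

lemma free_larger_then_smaller:
  assumes P: "P = SSLL \<or> P = SLSL" and "\<forall>x\<in>set S. x < c" "\<forall>x\<in>set L. c < x"
  shows "free P (c # L @ S) [] \<longleftrightarrow> free P (c # S) [] \<and> free P (L @ [c]) []"
proof -
  have "free P L S \<longleftrightarrow> free P L [c]"
  proof (rule free_cong)
    fix d s assume d: "d \<in> set L" and s: "suffix s P"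
    have "below d S = replicate (length S) True" "below d [c] = replicate 1 True"
      using d assms by (auto intro!: below_smaller[where c = c])
    then show "residual s (below d S) = [] \<longleftrightarrow> residual s (below d [c]) = []"
      using residual_trailing[of s "[]"] P s by (metis append_Nil)
  qed
  moreover have "below c S = replicate (length S) True" "below c L = replicate (length L) False"
    using assms by (auto intro!: below_smaller[where c = c] below_larger[where c = c])
  ultimately show ?thesis using P by auto
qed

interpretation SSLL: gluing SSLL glue_SSLL
proof
  fix X Y L S :: "nat list"
  assume "X = [] \<longleftrightarrow> Y = []"
  then show "mset (glue_SSLL L X Y S) = mset L + mset X + mset Y + mset S"
    by (rule parts_cases) auto
next
  fix X Y L S :: "nat list" and c
  assume XY: "X = [] \<longleftrightarrow> Y = []" and small: "\<forall>x\<in>set X \<union> set S. x < c"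
    and large: "\<forall>x\<in>set L \<union> set Y. c < x"
  note small = small[unfolded ball_Un] and large = large[unfolded ball_Un]
  show "lo c (glue_SSLL L X Y S) = X @ c # S \<and> hi c (glue_SSLL L X Y S) = L @ c # Y"
    using XY
  proof (cases rule: parts_cases)
    case 1
    then show ?thesis using larger_then_smaller_parts[of S c L] small large by simp
  next
    case (2 x X' Y' l)
    have "filter ((<) c) X' = []" "filter ((<) c) S = []" "filter ((<) c) Y' = Y'"
      using small large 2 by (auto intro!: filter_larger simp: filter_id_conv)
    moreover have "lo c (l # S) = c # S" using small large 2 by (simp add: lo_smaller)
    ultimately show ?thesis using small large 2
      by (auto simp: lo_append_larger lo_append_smaller[where y = l] lo_Cons_smaller[where y = l])
  qed
  show "free SSLL (c # glue_SSLL L X Y S) [] \<longleftrightarrow> free SSLL (X @ c # S) [] \<and> free SSLL (L @ c # Y) []"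
    using XY
  proof (cases rule: parts_cases)
    case 1
    then show ?thesis using free_larger_then_smaller[of SSLL S c L] small large by simp
  next
    case (2 x X' Y' l)
    \<comment> \<open>From a letter of \<open>L\<close>, both \<open>x\<close> and \<open>c\<close>
      are S, while \<open>X'\<close> and \<open>S\<close> are S blocks around \<open>l\<close>,
      which \<open>residual_block_cong\<close> removes.\<close>
    have L: "free SSLL L (x # Y' @ X' @ l # S) \<longleftrightarrow> free SSLL L (c # Y' @ [l])"
    proof (rule free_cong)
      fix d s assume d: "d \<in> set L" and s: "suffix s SSLL"
      have b: "below d X' = replicate (length X') True" "below d S = replicate (length S) True" "x < d" "c < d"
        using d small large 2 by (auto intro!: below_smaller[where c = c])
      have "suffix (residual s (True # below d Y')) SSLL"
        using s suffix_residual suffix_order.trans by blast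
      then have "residual (residual s (True # below d Y')) (replicate (length X') True @ [l < d] @ replicate (length S) True) = []
          \<longleftrightarrow> residual (residual s (True # below d Y')) [l < d] = []"
        by (rule residual_block_cong)
      then show "residual s (below d (x # Y' @ X' @ l # S)) = [] \<longleftrightarrow> residual s (below d (c # Y' @ [l])) = []"
        unfolding residual_append[symmetric] using b by simp
    qed
    have Y: "free SSLL Y' (X' @ l # S) \<longleftrightarrow> free SSLL Y' [l]"
    proof (rule free_cong)
      fix d s assume d: "d \<in> set Y'" and s: "suffix s SSLL"
      have "below d X' = replicate (length X') True" "below d S = replicate (length S) True"
        using d small large 2 by (auto intro!: below_smaller[where c = c])
      then show "residual s (below d (X' @ l # S)) = [] \<longleftrightarrow> residual s (below d [l]) = []"
        using residual_block_cong[OF s, of "length X'" "l < d" "length S"] by simp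
    qed
    \<comment> \<open>From a letter of \<open>X'\<close>, the letters \<open>l\<close> and
      \<open>c\<close> are both L.\<close>
    have X: "free SSLL X' (l # S) \<longleftrightarrow> free SSLL X' (c # S)"
    proof (rule free_cong)
      fix d s assume d: "d \<in> set X'" and s: "suffix s SSLL"
      have "\<not> l < d" "\<not> c < d" using d small large 2 by fastforce+
      then show "residual s (below d (l # S)) = [] \<longleftrightarrow> residual s (below d (c # S)) = []" by simp
    qed
    \<comment> \<open>It remains to treat \<open>c\<close>, \<open>x\<close> and \<open>l\<close>.
      In the word of \<open>c\<close> only one L follows the second S; the L block \<open>Y'\<close>
      in front of the word of \<open>x\<close> is skipped by a pattern starting with S; the word of
      \<open>l\<close> is constant.\<close>
    have "\<not> l < x" "\<not> c < x" "\<not> l < c" "x < c" using small large 2 by auto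
    moreover have "below x Y' = replicate (length Y') False" "below c Y' = replicate (length Y') False"
      "below c X' = replicate (length X') True" "below c S = replicate (length S) True"
      "below l S = replicate (length S) True" "below c L = replicate (length L) False"
      using small large 2 by (auto intro!: below_smaller[where c = c] below_larger[where c = c])
    ultimately show ?thesis using 2 L X Y by auto
  qed
next
  fix c p assume c: "c \<notin> set p" and "residual SSLL (below c p) \<noteq> []"
  then have P: "\<not> subseq SSLL (below c p)" by (simp add: residual_eq_Nil_iff)
  show "\<exists>L X Y S. (X = [] \<longleftrightarrow> Y = []) \<and> (\<forall>x\<in>set X \<union> set S. x < c) \<and>
      (\<forall>x\<in>set L \<union> set Y. c < x) \<and> p = glue_SSLL L X Y S"
    using c
  proof (cases rule: first_smaller_last_larger)
    case (1 L S)
    then show ?thesis by (intro exI[of _ L] exI[of _ "[]"] exI[of _ S]) auto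
  next
    case (2 L x M l S)
    then have "\<not> subseq [True, \<not> True] (below c M)"
      using P subseq_middle[of "[True, False]" c M x l L S] by auto
    then obtain U V where UV: "M = U @ V" "\<forall>x\<in>set U. \<not> x < c" "\<forall>x\<in>set V. x < c"
      using two_blocks[of True c M] by auto
    have "\<forall>x\<in>set U. c < x" using UV c 2(1) by (metis Un_iff linorder_neqE_nat list.set_intros(2) set_append)
    then have "\<forall>x\<in>set L \<union> set (U @ [l]). c < x" "\<forall>x\<in>set (x # V) \<union> set S. x < c"
      using 2 UV by (simp_all add: ball_Un)
    moreover have "p = glue_SSLL L (x # V) (U @ [l]) S" using 2(1) UV(1) by (simp)
    ultimately show ?thesis
      by (intro exI[of _ L] exI[of _ "x # V"] exI[of _ "U @ [l]"] exI[of _ S] conjI) (assumption | simp)+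
  qed
next
  fix n b show "residual SSLL (replicate n b) \<noteq> []" by (cases b) auto
qed

interpretation SLSL: gluing SLSL glue_SLSL
proof
  fix X Y L S :: "nat list"
  show "mset (glue_SLSL L X Y S) = mset L + mset X + mset Y + mset S"
    by (auto simp: glue_SLSL_def)
next
  fix X Y L S :: "nat list" and c
  assume XY: "X = [] \<longleftrightarrow> Y = []" and small: "\<forall>x\<in>set X \<union> set S. x < c"
    and large: "\<forall>x\<in>set L \<union> set Y. c < x"
  note small = small[unfolded ball_Un] and large = large[unfolded ball_Un]
  show "lo c (glue_SLSL L X Y S) = X @ c # S \<and> hi c (glue_SLSL L X Y S) = L @ c # Y"
    using XY
  proof (cases rule: parts_cases)
    case 1
    then show ?thesis
      using larger_then_smaller_parts[of S c L] small large by (simp add: glue_SLSL_def)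
  next
    case (2 x X' Y' l)
    have "filter ((<) c) X' = []" "filter ((<) c) S = []" "filter ((<) c) Y' = Y'"
      using small large 2 by (auto intro!: filter_larger simp: filter_id_conv)
    moreover have "lo c (l # S) = c # S" using small large 2 by (simp add: lo_smaller)
    ultimately show ?thesis using small large 2 unfolding glue_SLSL_def
      by (auto simp: lo_append_larger lo_append_smaller[where y = l] lo_Cons_smaller[where y = l])
  qed
  show "free SLSL (c # glue_SLSL L X Y S) [] \<longleftrightarrow> free SLSL (X @ c # S) [] \<and> free SLSL (L @ c # Y) []"
  proof (cases "X = []")
    case True
    then show ?thesis
      using free_larger_then_smaller[of SLSL S c L] small large XY by (simp add: glue_SLSL_def)
  next
    case False
    have L: "free SLSL L (X @ Y @ S) \<longleftrightarrow> free SLSL L (c # Y)"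
    proof (rule free_cong)
      fix d s assume d: "d \<in> set L" and s: "suffix s SLSL"
      have b: "below d X = replicate (length X) True" "below d S = replicate (length S) True" "c < d"
        using d small large by (auto intro!: below_smaller[where c = c])
      \<comment> \<open>Equal letters are never adjacent in SLSL, so a nonempty block acts like a
        single letter; here \<open>X\<close> acts like \<open>c\<close>.\<close>
      have "residual s (replicate (length X) True) = residual s [True]"
        using s False by (auto simp: suffix_Cons)
      moreover have "residual (residual s (True # below d Y)) (replicate (length S) True) = [] \<longleftrightarrow>
          residual s (True # below d Y) = []"
        unfolding residual_append[symmetric] using s by (intro residual_trailing disjI2)
      moreover have "residual s (True # below d Y) = residual (residual s [True]) (below d Y)"
        using residual_append[of s "[True]" "below d Y"] by simp
      ultimately show "residual s (below d (X @ Y @ S)) = [] \<longleftrightarrow> residual s (below d (c # Y)) = []"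
        using b by simp
    qed
    \<comment> \<open>Dually, from a letter of \<open>X\<close> the nonempty L block
      \<open>Y\<close> acts like the single larger letter \<open>c\<close>.\<close>
    have X: "free SLSL X (Y @ S) \<longleftrightarrow> free SLSL X (c # S)"
    proof (rule free_cong)
      fix d s assume d: "d \<in> set X" and s: "suffix s SLSL"
      have b: "below d Y = replicate (length Y) False" "\<not> c < d"
        using d small large by (auto intro!: below_larger[where c = c])
      have "residual s (replicate (length Y) False) = residual s [False]"
        using s False XY by (auto simp: suffix_Cons)
      moreover have "residual s (False # below d S) = residual (residual s [False]) (below d S)"
        using residual_append[of s "[False]" "below d S"] by simp
      ultimately show "residual s (below d (Y @ S)) = [] \<longleftrightarrow> residual s (below d (c # S)) = []"
        using b by simp
    qed
    have Y: "free SLSL Y S \<longleftrightarrow> free SLSL Y []"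
    proof (rule free_cong)
      fix d s assume d: "d \<in> set Y" and s: "suffix s SLSL"
      have "below d S = replicate (length S) True"
        using d small large by (auto intro!: below_smaller[where c = c])
      then show "residual s (below d S) = [] \<longleftrightarrow> residual s (below d []) = []"
        using residual_trailing[of s "[]"] s by simp
    qed
    \<comment> \<open>The word of \<open>c\<close> consists of blocks of L, S, L, S in this order,
      which leaves no place for the final L of SLSL.\<close>
    have "below c X = replicate (length X) True" "below c S = replicate (length S) True"
      "below c L = replicate (length L) False" "below c Y = replicate (length Y) False"
      using small large by (auto intro!: below_smaller[where c = c] below_larger[where c = c])
    then show ?thesis using L X Y by (auto simp: glue_SLSL_def)
  qed
next
  fix c p assume c: "c \<notin> set p" and "residual SLSL (below c p) \<noteq> []"
  then have P: "\<not> subseq SLSL (below c p)" by (simp add: residual_eq_Nil_iff)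
  show "\<exists>L X Y S. (X = [] \<longleftrightarrow> Y = []) \<and> (\<forall>x\<in>set X \<union> set S. x < c) \<and>
      (\<forall>x\<in>set L \<union> set Y. c < x) \<and> p = glue_SLSL L X Y S"
    using c
  proof (cases rule: first_smaller_last_larger)
    case (1 L S)
    then show ?thesis
      by (intro exI[of _ L] exI[of _ "[]"] exI[of _ S]) (auto simp: glue_SLSL_def)
  next
    case (2 L x M l S)
    then have "\<not> subseq [False, \<not> False] (below c M)"
      using P subseq_middle[of "[False, True]" c M x l L S] by auto
    then obtain U V where UV: "M = U @ V" "\<forall>x\<in>set U. x < c" "\<forall>x\<in>set V. \<not> x < c"
      using two_blocks[of False c M] by auto
    have "\<forall>x\<in>set V. c < x" using UV c 2(1) by (metis Un_iff linorder_neqE_nat list.set_intros(2) set_append)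
    then have "\<forall>x\<in>set L \<union> set (V @ [l]). c < x" "\<forall>x\<in>set (x # U) \<union> set S. x < c"
      using 2 UV by (simp_all add: ball_Un)
    moreover have "p = glue_SLSL L (x # U) (V @ [l]) S" using 2(1) UV(1) by (simp add: glue_SLSL_def)
    ultimately show ?thesis
      by (intro exI[of _ L] exI[of _ "x # U"] exI[of _ "V @ [l]"] exI[of _ S] conjI) (assumption | simp)+
  qed
next
  fix n b show "residual SLSL (replicate n b) \<noteq> []" by (cases b) auto
qed

section \<open>Equidistribution\<close>

definition equidistributed :: "nat list set \<Rightarrow> nat list set \<Rightarrow> bool" where
  "equidistributed X Y \<longleftrightarrow> (\<exists>f. bij_betw f X Y \<and> (\<forall>x\<in>X. st (f x) = st x))"

lemma equidistributed_refl: "equidistributed X X"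
  unfolding equidistributed_def by (intro exI[of _ id]) auto

text \<open>The bijection chosen for each first letter keeps that letter, so the images are disjoint
  and the bijections paste together.\<close>

lemma equidistributed_hd:
  assumes "\<And>c. equidistributed {x \<in> X. hd x = c} {y \<in> Y. hd y = c}"
  shows "equidistributed X Y"
proof -
  have "\<forall>c. \<exists>f. bij_betw f {x \<in> X. hd x = c} {y \<in> Y. hd y = c} \<and> (\<forall>x\<in>{x \<in> X. hd x = c}. st (f x) = st x)"
    using assms unfolding equidistributed_def by blast
  from choice[OF this] obtain f where
    f: "\<And>c. bij_betw (f c) {x \<in> X. hd x = c} {y \<in> Y. hd y = c}"
    and st: "\<And>c x. x \<in> X \<Longrightarrow> hd x = c \<Longrightarrow> st (f c x) = st x"
    by blast
  define g where "g x = f (hd x) x" for x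
  have g: "g x \<in> Y \<and> hd (g x) = hd x" if "x \<in> X" for x
    using bij_betwE[OF f[of "hd x"]] that by (auto simp: g_def)
  have "inj_on g X"
  proof (rule inj_onI)
    fix x y assume xy: "x \<in> X" "y \<in> X" "g x = g y"
    then have "hd x = hd y" using g by metis
    then show "x = y"
      using inj_onD[OF bij_betw_imp_inj_on[OF f[of "hd x"]], of x y] xy by (simp add: g_def)
  qed
  moreover have "y \<in> g ` X" if "y \<in> Y" for y
  proof -
    have "y \<in> f (hd y) ` {x \<in> X. hd x = hd y}"
      using bij_betw_imp_surj_on[OF f[of "hd y"]] that by blast
    then obtain x where "x \<in> X" "hd x = hd y" "y = f (hd y) x" by blast
    then show ?thesis by (intro image_eqI[of _ _ x]) (simp_all add: g_def)
  qed
  ultimately have "bij_betw g X Y" using g unfolding bij_betw_def by blast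
  then show ?thesis unfolding equidistributed_def using st by (auto simp: g_def)
qed

lemma equidistributed_Cons:
  assumes "equidistributed X Y" and F: "\<And>p. p \<in> X \<union> Y \<Longrightarrow> st (c # p) = F (st p)"
  shows "equidistributed (Cons c ` X) (Cons c ` Y)"
proof -
  obtain f where f: "bij_betw f X Y" "\<And>x. x \<in> X \<Longrightarrow> st (f x) = st x"
    using assms(1) unfolding equidistributed_def by blast
  have "bij_betw (\<lambda>p. c # f (tl p)) (Cons c ` X) (Cons c ` Y)"
    using f(1) unfolding bij_betw_def inj_on_def by force
  moreover have "st (c # f x) = st (c # x)" if "x \<in> X" for x
    using F[of x] F[of "f x"] f(2)[OF that] bij_betwE[OF f(1)] that by auto
  ultimately show ?thesis unfolding equidistributed_def by (intro exI conjI) auto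
qed

text \<open>Decompose a word by \<open>D\<close>, transport each part, and reassemble inside
  \<open>Y\<close>. Both the selection \<open>G\<close> and the recombination \<open>F\<close> see
  only statistics, so they survive the transport.\<close>

lemma equidistributed_pairs:
  assumes U: "equidistributed U U'" and V: "equidistributed V V'"
    and X: "bij_betw D X {(u, v) \<in> U \<times> V. G (st u) (st v)}"
    and Y: "bij_betw D Y {(u, v) \<in> U' \<times> V'. G (st u) (st v)}"
    and F: "\<And>p. p \<in> X \<union> Y \<Longrightarrow> st p = F (st (fst (D p))) (st (snd (D p)))"
  shows "equidistributed X Y"
proof -
  obtain f where f: "bij_betw f U U'" "\<And>x. x \<in> U \<Longrightarrow> st (f x) = st x"
    using U unfolding equidistributed_def by blast
  obtain g where g: "bij_betw g V V'" "\<And>x. x \<in> V \<Longrightarrow> st (g x) = st x"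
    using V unfolding equidistributed_def by blast
  let ?T = "{(u, v) \<in> U \<times> V. G (st u) (st v)}" and ?T' = "{(u, v) \<in> U' \<times> V'. G (st u) (st v)}"
  have fU: "f u \<in> U'" if "u \<in> U" for u using bij_betwE[OF f(1)] that by blast
  have gV: "g v \<in> V'" if "v \<in> V" for v using bij_betwE[OF g(1)] that by blast
  have T: "bij_betw (map_prod f g) ?T ?T'"
  proof (rule bij_betw_imageI)
    show "inj_on (map_prod f g) ?T"
      using f(1) g(1) unfolding bij_betw_def inj_on_def by auto
    have "t \<in> map_prod f g ` ?T" if t: "t \<in> ?T'" for t
    proof -
      obtain u' v' where t': "t = (u', v')" "u' \<in> U'" "v' \<in> V'" "G (st u') (st v')" using t by auto
      obtain u v where "u \<in> U" "f u = u'" "v \<in> V" "g v = v'"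
        using t' f(1) g(1) unfolding bij_betw_def by blast
      then show ?thesis using t' f(2) g(2) by (intro image_eqI[of _ _ "(u, v)"]) auto
    qed
    then show "map_prod f g ` ?T = ?T'" using f(2) g(2) fU gV by auto
  qed
  let ?h = "inv_into Y D \<circ> (map_prod f g \<circ> D)"
  have "bij_betw ?h X Y"
    by (rule bij_betw_trans[OF bij_betw_trans[OF X T] bij_betw_inv_into[OF Y]])
  moreover have "st (?h p) = st p" if p: "p \<in> X" for p
  proof -
    have D: "D p \<in> ?T" using bij_betwE[OF X] p by (rule bspec)
    have "map_prod f g (D p) \<in> ?T'" using bij_betwE[OF T] D by (rule bspec)
    then have Dh: "D (?h p) = map_prod f g (D p)"
      using bij_betw_inv_into_right[OF Y] by simp
    have "?h p \<in> Y" using bij_betwE[OF \<open>bij_betw ?h X Y\<close>] p by blast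
    then have "st (?h p) = F (st (fst (D (?h p)))) (st (snd (D (?h p))))" using F by blast
    also have "\<dots> = F (st (fst (D p))) (st (snd (D p)))"
      unfolding Dh using D f(2) g(2) by (auto simp: case_prod_unfold)
    also have "\<dots> = st p" using F p by simp
    finally show ?thesis .
  qed
  ultimately show ?thesis unfolding equidistributed_def by blast
qed

text \<open>The right side must be a function of \<open>st p\<close> alone to fit
  \<open>equidistributed_Cons\<close>; emptiness of \<open>p\<close> is therefore expressed by
  \<open>b \<le> Suc a\<close>.\<close>

lemma st_Cons_least:
  assumes "set p = {Suc a..<b}"
  shows "st (a # p) = (\<lambda>(d, m, k, r, i). (d, insert a m, {a}, if b \<le> Suc a then insert a r else r, insert a i)) (st p)"
proof -
  have gt: "a < x" if "x \<in> set p" for x using that assms by simp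
  have "{i \<in> set p. i + 1 = a} = {}" using gt by fastforce
  moreover have "{y \<in> Lrmax p. a < y} = Lrmax p" using Lrmax_subset gt by blast
  moreover have "{y \<in> Lrmin p. y < a} = {}" using Lrmin_subset gt order.asym by blast
  moreover have "(\<forall>y\<in>set p. y < a) \<longleftrightarrow> b \<le> Suc a"
    unfolding assms by (metis Suc_n_not_le_n atLeastLessThan_iff le_eq_less_or_eq less_le_trans nat_le_linear not_less)
  moreover have "(if p \<noteq> [] \<and> a < hd p then Iar p else {}) = Iar p"
    using gt by (cases p) auto
  ultimately show ?thesis
    unfolding st_def by (simp only: Ids_Cons Lrmax_Cons Lrmin_Cons Rlmax_Cons Iar_Cons prod.case Un_empty_left)
qed

lemma st_Cons_greatest:
  assumes "set p = {a..<c}" "a < c"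
  shows "st (c # p) = (\<lambda>(d, m, k, r, i). (insert (c - 1) d, {c}, insert c k, insert c r, {c})) (st p)"
proof -
  have lt: "x < c" if "x \<in> set p" for x using that assms by simp
  have "{i \<in> set p. i + 1 = c} = {c - 1}" using assms by auto
  then have "Ids (c # p) = insert (c - 1) (Ids p)" by simp
  moreover have "{y \<in> Lrmin p. y < c} = Lrmin p" using Lrmin_subset lt by blast
  moreover have "{y \<in> Lrmax p. c < y} = {}" using Lrmax_subset lt order.asym by blast
  moreover have "Iar (c # p) = {c}" using lt by (cases p) (auto dest: order.asym)
  moreover have "Rlmax (c # p) = insert c (Rlmax p)" using lt by simp
  ultimately show ?thesis
    unfolding st_def by (simp only: Lrmax_Cons Lrmin_Cons prod.case)
qed

text \<open>Induction on the length of the interval, with the first letter fixed: an extreme first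
  letter is deleted, an interior one splits the word.\<close>

lemma equidistributed_Av: "equidistributed (Av SSLL {a..<b}) (Av SLSL {a..<b})"
proof (induction "b - a" arbitrary: a b rule: less_induct)
  case less
  show ?case
  proof (rule equidistributed_hd)
    fix c
    \<comment> \<open>\<open>c\<close> is an arbitrary number here, so empty intervals and values
      outside the interval are included.\<close>
    consider "b \<le> a" | "a < b" "c \<notin> {a..<b}" | "a < b" "c = a" | "a < c" "b = Suc c" | "a < c" "Suc c < b"
      by (cases "a < b"; cases "c \<in> {a..<b}") (auto simp: not_less less_Suc_eq_le nat_less_le)
    then show "equidistributed {p \<in> Av SSLL {a..<b}. hd p = c} {p \<in> Av SLSL {a..<b}. hd p = c}"
    proof cases
      case 1
      then have "Av SSLL {a..<b} = Av SLSL {a..<b}" by (auto simp: Av_def)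
      then show ?thesis by (simp add: equidistributed_refl)
    next
      case 2
      have "hd p \<noteq> c" if "p \<in> Av P {a..<b}" for P p
      proof -
        have p: "set p = {a..<b}" using that by (simp add: Av_def)
        then have "p \<noteq> []" using 2(1) by auto
        then show ?thesis using p 2(2) hd_in_set by blast
      qed
      then have empty: "{p \<in> Av P {a..<b}. hd p = c} = {}" for P by blast
      show ?thesis unfolding empty by (rule equidistributed_refl)
    next
      case 3
      have "b - Suc a < b - a" using 3 by simp
      then have "equidistributed (Av SSLL {Suc a..<b}) (Av SLSL {Suc a..<b})" by (rule less)
      then have "equidistributed (Cons a ` Av SSLL {Suc a..<b}) (Cons a ` Av SLSL {Suc a..<b})"
        by (rule equidistributed_Cons) (auto simp only: Av_def intro: st_Cons_least)
      then show ?thesis using 3 by (simp add: SSLL.Av_hd_least SLSL.Av_hd_least)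
    next
      case 4
      have "c - a < b - a" using 4 by simp
      then have "equidistributed (Av SSLL {a..<c}) (Av SLSL {a..<c})" by (rule less)
      then have "equidistributed (Cons c ` Av SSLL {a..<c}) (Cons c ` Av SLSL {a..<c})"
        by (rule equidistributed_Cons) (use 4 in \<open>auto simp only: Av_def intro: st_Cons_greatest\<close>)
      then show ?thesis using 4 by (simp add: SSLL.Av_hd_greatest SLSL.Av_hd_greatest)
    next
      case 5
      \<comment> \<open>Although both parts contain \<open>c\<close>, each misses a letter on the
        other side of it, because \<open>c\<close> is interior.\<close>
      have "Suc c - a < b - a" "b - c < b - a" using 5 by simp_all
      then have "equidistributed (Av SSLL {a..<Suc c}) (Av SLSL {a..<Suc c})"
        "equidistributed (Av SSLL {c..<b}) (Av SLSL {c..<b})" using less by blast+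
      then show ?thesis
      proof (rule equidistributed_pairs[OF _ _ SSLL.bij_betw_parts[OF 5] SLSL.bij_betw_parts[OF 5]])
        fix p assume "p \<in> {p \<in> Av SSLL {a..<b}. hd p = c} \<union> {p \<in> Av SLSL {a..<b}. hd p = c}"
        then have p: "distinct p" "set p = {a..<b}" "hd p = c" unfolding Av_def by blast+
        then obtain q where q: "p = c # q" using 5 by (cases p) auto
        have "c \<notin> set q" using p q by simp
        moreover have "c - 1 \<in> set p" "c - 1 \<noteq> c" "Suc c \<in> set p" unfolding p using 5 by auto
        then have "c - 1 \<in> set q" "\<exists>y\<in>set q. c < y" using q by auto
        ultimately have "st (c # q) = st_join c (st (lo c q)) (st (hi c q))"
          using 5 by (intro st_Cons_split) auto
        then show "st p = st_join c (st (fst (lo c (tl p), hi c (tl p)))) (st (snd (lo c (tl p), hi c (tl p))))"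
          by (simp add: q)
      qed
    qed
  qed
qed

section \<open>Pattern containment\<close>

lemma contains_length5:
  "contains p [a, b, c, d, e] \<longleftrightarrow> (\<exists>i0 i1 i2 i3 i4.
     i0 < i1 \<and> i1 < i2 \<and> i2 < i3 \<and> i3 < i4 \<and> i4 < length p \<and>
     (\<forall>i<5. \<forall>j<5. [p ! i0, p ! i1, p ! i2, p ! i3, p ! i4] ! i < [p ! i0, p ! i1, p ! i2, p ! i3, p ! i4] ! j
        \<longleftrightarrow> [a, b, c, d, e] ! i < [a, b, c, d, e] ! j))"
    (is "?l \<longleftrightarrow> ?r")
proof -
  have len: "length [a, b, c, d, e] = 5" by simp
  show ?thesis
  proof
    assume ?l
    then obtain idx where idx: "length idx = 5" "sorted_wrt (<) idx" "\<forall>t\<in>set idx. t < length p"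
      "\<forall>i<5. \<forall>j<5. p ! (idx ! i) < p ! (idx ! j) \<longleftrightarrow> [a, b, c, d, e] ! i < [a, b, c, d, e] ! j"
      unfolding contains_def len by blast
    obtain i0 i1 i2 i3 i4 where i: "idx = [i0, i1, i2, i3, i4]"
      using idx(1) by (auto simp: length_Suc_conv numeral_eq_Suc)
    have "\<forall>i<5. \<forall>j<5. map ((!) p) idx ! i < map ((!) p) idx ! j \<longleftrightarrow> [a, b, c, d, e] ! i < [a, b, c, d, e] ! j"
      using idx(1,4) by simp
    then show ?r using idx(2,3) unfolding i by (intro exI conjI) auto
  next
    assume ?r
    then obtain i0 i1 i2 i3 i4 where i: "i0 < i1" "i1 < i2" "i2 < i3" "i3 < i4" "i4 < length p"
      "\<forall>i<5. \<forall>j<5. map ((!) p) [i0, i1, i2, i3, i4] ! i < map ((!) p) [i0, i1, i2, i3, i4] ! j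
         \<longleftrightarrow> [a, b, c, d, e] ! i < [a, b, c, d, e] ! j"
      by auto
    moreover have "p ! ([i0, i1, i2, i3, i4] ! i) = map ((!) p) [i0, i1, i2, i3, i4] ! i" if "i < 5" for i
      using that by (subst nth_map) auto
    ultimately show ?l
      unfolding contains_def len by (intro exI[of _ "[i0, i1, i2, i3, i4]"] conjI) simp_all
  qed
qed

text \<open>As the pattern has distinct entries, trichotomy turns one implication into the
  equivalence. The bounds are written with \<open>Suc\<close> so that \<open>All_less_Suc\<close>
  unfolds them.\<close>

lemma contains_length5I:
  assumes "i0 < i1" "i1 < i2" "i2 < i3" "i3 < i4" "i4 < length p" and dist: "distinct [a, b, c, d, e]"
    and mono: "\<forall>i<Suc (Suc (Suc (Suc (Suc 0)))). \<forall>j<Suc (Suc (Suc (Suc (Suc 0)))).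
      [a, b, c, d, e] ! i < [a, b, c, d, e] ! j \<longrightarrow>
      [p ! i0, p ! i1, p ! i2, p ! i3, p ! i4] ! i < [p ! i0, p ! i1, p ! i2, p ! i3, p ! i4] ! j"
  shows "contains p [a, b, c, d, e]"
proof -
  have "[p ! i0, p ! i1, p ! i2, p ! i3, p ! i4] ! i < [p ! i0, p ! i1, p ! i2, p ! i3, p ! i4] ! j
      \<longleftrightarrow> [a, b, c, d, e] ! i < [a, b, c, d, e] ! j" if "i < 5" "j < 5" for i j
  proof -
    have "i < Suc (Suc (Suc (Suc (Suc 0))))" "j < Suc (Suc (Suc (Suc (Suc 0))))" using that by simp_all
    then have "[a, b, c, d, e] ! i < [a, b, c, d, e] ! j \<longrightarrow>
        [p ! i0, p ! i1, p ! i2, p ! i3, p ! i4] ! i < [p ! i0, p ! i1, p ! i2, p ! i3, p ! i4] ! j"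
      "[a, b, c, d, e] ! j < [a, b, c, d, e] ! i \<longrightarrow>
        [p ! i0, p ! i1, p ! i2, p ! i3, p ! i4] ! j < [p ! i0, p ! i1, p ! i2, p ! i3, p ! i4] ! i"
      using mono by blast+
    moreover have "[a, b, c, d, e] ! i = [a, b, c, d, e] ! j \<longrightarrow> i = j"
      using nth_eq_iff_index_eq[OF dist] that by simp
    ultimately show ?thesis by (metis linorder_neqE_nat order.asym)
  qed
  then show ?thesis unfolding contains_length5 using assms(1-5) by blast
qed

text \<open>Positions refer to \<open>p\<close> itself, so repeated unfolding yields an increasing
  chain of positions.\<close>

lemma subseq_Cons_below_drop:
  "subseq (e # P) (below c (drop k p)) \<longleftrightarrow>
    (\<exists>i. k \<le> i \<and> i < length p \<and> (p ! i < c) = e \<and> subseq P (below c (drop (Suc i) p)))"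
    (is "?l \<longleftrightarrow> ?r")
proof
  assume ?l
  then obtain i where "i < length p - k" "(p ! (k + i) < c) = e" "subseq P (below c (drop (Suc (k + i)) p))"
    unfolding subseq_Cons_iff_nth by (auto simp: below_def drop_map add.commute)
  then show ?r by (intro exI[of _ "k + i"]) auto
next
  assume ?r
  then obtain i where "k \<le> i" "i < length p" "(p ! i < c) = e" "subseq P (below c (drop (Suc i) p))"
    by blast
  then show ?l
    unfolding subseq_Cons_iff_nth by (intro exI[of _ "i - k"]) (auto simp: below_def drop_map)
qed

lemma not_free_iff: "\<not> free P p [] \<longleftrightarrow> (\<exists>i<length p. subseq P (below (p ! i) (drop (Suc i) p)))"
proof (induction p)
  case (Cons d p)
  show ?case unfolding Ex_less_Suc2 length_Cons using Cons by (auto simp: residual_eq_Nil_iff)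
qed simp

lemma not_free_length4_iff:
  "\<not> free [e1, e2, e3, e4] p [] \<longleftrightarrow> (\<exists>i0 i1 i2 i3 i4.
     i0 < i1 \<and> i1 < i2 \<and> i2 < i3 \<and> i3 < i4 \<and> i4 < length p \<and>
     (p ! i1 < p ! i0) = e1 \<and> (p ! i2 < p ! i0) = e2 \<and> (p ! i3 < p ! i0) = e3 \<and> (p ! i4 < p ! i0) = e4)"
    (is "?l \<longleftrightarrow> ?r")
proof
  assume ?l
  then show ?r unfolding not_free_iff subseq_Cons_below_drop Suc_le_eq by blast
next
  assume ?r
  then obtain i0 i1 i2 i3 i4 where
    i: "i0 < i1" "i1 < i2" "i2 < i3" "i3 < i4" "i4 < length p"
      "(p ! i1 < p ! i0) = e1" "(p ! i2 < p ! i0) = e2" "(p ! i3 < p ! i0) = e3" "(p ! i4 < p ! i0) = e4"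
    by blast
  then have "i0 < length p" "i1 < length p" "i2 < length p" "i3 < length p" by simp_all
  then show ?l
    unfolding not_free_iff subseq_Cons_below_drop Suc_le_eq using i list_emb_Nil by blast
qed

text \<open>The four patterns are 3 followed by 1, 2 in either order and then 4, 5 in either order.
  Together they prescribe only the comparisons with the first letter.\<close>

lemma contains_SSLL_iff:
  assumes "distinct p"
  shows "(\<exists>P\<in>set [[3,1,2,4,5],[3,2,1,4,5],[3,1,2,5,4],[3,2,1,5,4]]. contains p P) \<longleftrightarrow> \<not> free SSLL p []"
proof
  assume "\<exists>P\<in>set [[3,1,2,4,5],[3,2,1,4,5],[3,1,2,5,4],[3,2,1,5,4]]. contains p P"
  then show "\<not> free SSLL p []"
    unfolding not_free_length4_iff
    by (simp add: contains_length5 numeral_eq_Suc All_less_Suc) (smt (verit) not_less_iff_gr_or_eq)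
next
  assume "\<not> free SSLL p []"
  then obtain i0 i1 i2 i3 i4 where
    i: "i0 < i1" "i1 < i2" "i2 < i3" "i3 < i4" "i4 < length p"
      "p ! i1 < p ! i0" "p ! i2 < p ! i0" "\<not> p ! i3 < p ! i0" "\<not> p ! i4 < p ! i0"
    unfolding not_free_length4_iff by blast
  \<comment> \<open>Distinctness makes the negated comparisons strict and orders each pair, which
    selects one of the four patterns.\<close>
  have neq: "p ! i1 \<noteq> p ! i2" "p ! i3 \<noteq> p ! i4" "p ! i3 \<noteq> p ! i0" "p ! i4 \<noteq> p ! i0"
    using assms i by (simp_all add: nth_eq_iff_index_eq)
  have ord: "p ! i1 < p ! i0" "p ! i2 < p ! i0" "p ! i0 < p ! i3" "p ! i0 < p ! i4"
    using i neq by simp_all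
  from neq(1,2) consider
    "p ! i1 < p ! i2" "p ! i3 < p ! i4"
  | "p ! i2 < p ! i1" "p ! i3 < p ! i4"
  | "p ! i1 < p ! i2" "p ! i4 < p ! i3"
  | "p ! i2 < p ! i1" "p ! i4 < p ! i3"
    by linarith
  then show "\<exists>P\<in>set [[3,1,2,4,5],[3,2,1,4,5],[3,1,2,5,4],[3,2,1,5,4]]. contains p P"
  proof cases
    case 1
    then have "contains p [3,1,2,4,5]" using ord
      by (intro contains_length5I[OF i(1-5)]) (simp_all add: All_less_Suc)
    then show ?thesis by simp
  next
    case 2
    then have "contains p [3,2,1,4,5]" using ord
      by (intro contains_length5I[OF i(1-5)]) (simp_all add: All_less_Suc)
    then show ?thesis by simp
  next
    case 3
    then have "contains p [3,1,2,5,4]" using ord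
      by (intro contains_length5I[OF i(1-5)]) (simp_all add: All_less_Suc)
    then show ?thesis by simp
  next
    case 4
    then have "contains p [3,2,1,5,4]" using ord
      by (intro contains_length5I[OF i(1-5)]) (simp_all add: All_less_Suc)
    then show ?thesis by simp
  qed
qed

text \<open>The same argument with the small letters 1, 2 and the large letters 4, 5 alternating
  after the 3.\<close>

lemma contains_SLSL_iff:
  assumes "distinct p"
  shows "(\<exists>P\<in>set [[3,1,4,2,5],[3,2,4,1,5],[3,1,5,2,4],[3,2,5,1,4]]. contains p P) \<longleftrightarrow> \<not> free SLSL p []"
proof
  assume "\<exists>P\<in>set [[3,1,4,2,5],[3,2,4,1,5],[3,1,5,2,4],[3,2,5,1,4]]. contains p P"
  then show "\<not> free SLSL p []"
    unfolding not_free_length4_iff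
    by (simp add: contains_length5 numeral_eq_Suc All_less_Suc) (smt (verit) not_less_iff_gr_or_eq)
next
  assume "\<not> free SLSL p []"
  then obtain i0 i1 i2 i3 i4 where
    i: "i0 < i1" "i1 < i2" "i2 < i3" "i3 < i4" "i4 < length p"
      "p ! i1 < p ! i0" "\<not> p ! i2 < p ! i0" "p ! i3 < p ! i0" "\<not> p ! i4 < p ! i0"
    unfolding not_free_length4_iff by blast
  have neq: "p ! i1 \<noteq> p ! i3" "p ! i2 \<noteq> p ! i4" "p ! i2 \<noteq> p ! i0" "p ! i4 \<noteq> p ! i0"
    using assms i by (simp_all add: nth_eq_iff_index_eq)
  have ord: "p ! i1 < p ! i0" "p ! i3 < p ! i0" "p ! i0 < p ! i2" "p ! i0 < p ! i4"
    using i neq by simp_all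
  from neq(1,2) consider
    "p ! i1 < p ! i3" "p ! i2 < p ! i4"
  | "p ! i3 < p ! i1" "p ! i2 < p ! i4"
  | "p ! i1 < p ! i3" "p ! i4 < p ! i2"
  | "p ! i3 < p ! i1" "p ! i4 < p ! i2"
    by linarith
  then show "\<exists>P\<in>set [[3,1,4,2,5],[3,2,4,1,5],[3,1,5,2,4],[3,2,5,1,4]]. contains p P"
  proof cases
    case 1
    then have "contains p [3,1,4,2,5]" using ord
      by (intro contains_length5I[OF i(1-5)]) (simp_all add: All_less_Suc)
    then show ?thesis by simp
  next
    case 2
    then have "contains p [3,2,4,1,5]" using ord
      by (intro contains_length5I[OF i(1-5)]) (simp_all add: All_less_Suc)
    then show ?thesis by simp
  next
    case 3
    then have "contains p [3,1,5,2,4]" using ord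
      by (intro contains_length5I[OF i(1-5)]) (simp_all add: All_less_Suc)
    then show ?thesis by simp
  next
    case 4
    then have "contains p [3,2,5,1,4]" using ord
      by (intro contains_length5I[OF i(1-5)]) (simp_all add: All_less_Suc)
    then show ?thesis by simp
  qed
qed

text \<open>Both \<open>i\<close> and \<open>Suc i\<close> are letters of \<open>p\<close>, so on
  the letters from 1 to \<open>n\<close> the range condition holds automatically.\<close>

lemma Ides_eq_Ids:
  assumes "set p = {1..n}" "length p = n"
  shows "Ides p = Ids p"
proof -
  have "1 \<le> i \<and> i \<le> length p - 1" if "i \<in> Ids p" for i
    using Ids_subset[of p] that assms by auto
  then show ?thesis unfolding Ides_def Ids_def by blast
qed

theorem theorem1p1:
  fixes n :: nat
  assumes "n \<ge> 1"
  shows "\<exists>\<alpha>. bij_betw \<alpha>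
            (avoiding n [[3,1,2,4,5],[3,2,1,4,5],[3,1,2,5,4],[3,2,1,5,4]])
            (avoiding n [[3,1,4,2,5],[3,2,4,1,5],[3,1,5,2,4],[3,2,5,1,4]])
          \<and> (\<forall>\<pi>\<in>avoiding n [[3,1,2,4,5],[3,2,1,4,5],[3,1,2,5,4],[3,2,1,5,4]].
               (Ides \<pi>, Lrmax \<pi>, Lrmin \<pi>, Rlmax \<pi>, Iar \<pi>)
             = (Ides (\<alpha> \<pi>), Lrmax (\<alpha> \<pi>), Lrmin (\<alpha> \<pi>), Rlmax (\<alpha> \<pi>), Iar (\<alpha> \<pi>)))"
proof -
  have perms: "p \<in> perms n \<longleftrightarrow> distinct p \<and> set p = {1..<Suc n}" for p
    unfolding perms_def atLeastLessThanSuc_atLeastAtMost using distinct_card[of p] by auto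
  have A: "avoiding n [[3,1,2,4,5],[3,2,1,4,5],[3,1,2,5,4],[3,2,1,5,4]] = Av SSLL {1..<Suc n}"
    unfolding avoiding_def Av_def perms using contains_SSLL_iff by blast
  have B: "avoiding n [[3,1,4,2,5],[3,2,4,1,5],[3,1,5,2,4],[3,2,5,1,4]] = Av SLSL {1..<Suc n}"
    unfolding avoiding_def Av_def perms using contains_SLSL_iff by blast
  have Ides: "Ides p = Ids p" if "p \<in> Av P {1..<Suc n}" for P p
    using that distinct_card[of p] unfolding Av_def atLeastLessThanSuc_atLeastAtMost
    by (intro Ides_eq_Ids[of _ n]) auto
  obtain f where f: "bij_betw f (Av SSLL {1..<Suc n}) (Av SLSL {1..<Suc n})"
    and st: "\<And>p. p \<in> Av SSLL {1..<Suc n} \<Longrightarrow> st (f p) = st p"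
    using equidistributed_Av[of 1 "Suc n"] unfolding equidistributed_def by blast
  have "(Ides p, Lrmax p, Lrmin p, Rlmax p, Iar p)
      = (Ides (f p), Lrmax (f p), Lrmin (f p), Rlmax (f p), Iar (f p))"
    if p: "p \<in> Av SSLL {1..<Suc n}" for p
  proof -
    have "f p \<in> Av SLSL {1..<Suc n}" using bij_betwE[OF f] p by blast
    then show ?thesis using st[OF p] Ides[OF p] Ides[of "f p"] unfolding st_def by simp
  qed
  then show ?thesis unfolding A B using f by blast
qed

end
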